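(* Let $f:M\to\mathbb{R}$ be a differentiable function and let $g_i:M\to\mathbb{R}$, $i=1,\ldots,l$, be geodesic convex functions. Consider the problem of minimizing $f(x)$ subject to $x\in S=\{x\in M: g_i(x)\le 0,\ i=1,\ldots,l\}$. Let $\bar x$ be a local optimal solution of this problem, with each $g_i$ differentiable at $\bar x$. If $C_S(\bar x)\subset \mathrm{co}\,T_S(\bar x)$, where $\mathrm{co}$ denotes the convex hull, then there exist real numbers $\bar\lambda_1,\ldots,\bar\lambda_l$ such that $$\begin{cases}\mathrm{grad}f(\bar x)+\sum_{i=1}^l\bar\lambda_i\,\mathrm{grad}g_i(\bar x)=0;\\ \bar\lambda_i\ge0,\quad g_i(\bar x)\le0,\quad \bar\lambda_i g_i(\bar x)=0,\quad i=1,\ldots,l.\end{cases}$$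
   Context: $M$ is a smooth, simply connected, Hausdorff $m$-dimensional manifold with a countable atlas, endowed with a Riemannian metric $\langle\cdot,\cdot\rangle$ with norm $\|\cdot\|$, exponential map $\exp$ and Riemannian distance $d$; $\mathrm{grad}$ is the Riemannian gradient. A geodesic from $x$ to $y$ is minimal if its length is $d(x,y)$. A function $g:M\to\mathbb{R}$ is geodesic convex if for every geodesic $\gamma$ of $M$ the composition $g\circ\gamma$ is convex. $\bar x\in S$ is a local optimal solution if $f(x)\ge f(\bar x)$ for all $x\in S$ in some neighborhood of $\bar x$. Convexity of sets: $A\subset M$ is strongly geodesic convex if for any $x,y\in A$ there is exactly one minimal geodesic of $M$ from $x$ to $y$ and it lies in $A$. For $p\in M$, the geodesic convex radius $r(p)>0$ is the largest number such that for all $0<r\le r(p)$ the open ball $\mathrm{Bal}_M(p,r)$ is strongly geodesic convex and each geodesic in $\mathrm{Bal}_M(p,r)$ is minimal. $C\subset M$ is locally geodesic convex if for every $p\in\mathrm{cl}(C)$ there is $0<\varepsilon(p)<r(p)$ such that $C\cap \mathrm{Bal}_M(p,\varepsilon(p))$ is strongly geodesic convex. The feasible set $S$ is locally geodesic convex because the $g_i$ are geodesic convex. $\mathrm{int}(C)$ denotes the union of all $k$-dimensional submanifolds of $M$ contained in $C$, where $k$ is the largest dimension of a submanifold of $M$ contained in $C$ (relative interior). Cones: for a locally geodesic convex set $C$ and $p\in C$, the tangent cone is $T_C(p)=\{v\in T_pM\setminus\{0\}:\exp_p\big(t\frac{v}{\|v\|}\big)\in\mathrm{int}(C)\text{ for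 some }0<t<\varepsilon(p)\}\cup\{0\}$. The active index set is $I(\bar x)=\{i:g_i(\bar x)=0\}$ and the linearization cone is $C_S(\bar x)=\{y\in T_{\bar x}M:\langle\mathrm{grad}g_i(\bar x),y\rangle_{T_{\bar x}M}\le0,\ i\in I(\bar x)\}$. *)

theory Defs
  imports "HOL-Analysis.Analysis"
begin

section \<open>Smooth manifolds\<close>

text \<open>
  The manifold is the whole of a Hausdorff type 'a, modelled on the Euclidean space 'b, so that
  its dimension is DIM('b). A chart is a pair of an open domain U and a map that is a
  homeomorphism from U onto an open subset of 'b; the values of the map outside U are irrelevant.
\<close>

type_synonym ('a, 'b) chart = "'a set \<times> ('a \<Rightarrow> 'b)"

abbreviation dom_of :: "('a, 'b) chart \<Rightarrow> 'a set" where
  "dom_of c \<equiv> fst c"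

abbreviation map_of_chart :: "('a, 'b) chart \<Rightarrow> 'a \<Rightarrow> 'b" where
  "map_of_chart c \<equiv> snd c"

abbreviation inv_chart :: "('a, 'b) chart \<Rightarrow> 'b \<Rightarrow> 'a" where
  "inv_chart c \<equiv> inv_into (dom_of c) (map_of_chart c)"

definition is_chart :: "('a::topological_space, 'b::euclidean_space) chart \<Rightarrow> bool" where
  "is_chart c \<longleftrightarrow> open (dom_of c) \<and> open (map_of_chart c ` dom_of c) \<and>
     homeomorphism (dom_of c) (map_of_chart c ` dom_of c) (map_of_chart c) (inv_chart c)"

text \<open>Functions of class \<open>C\<^sup>k\<close> and \<open>C\<^sup>\<infinity>\<close> on an open subset of a Euclidean space.\<close>

fun Ck_on :: "nat \<Rightarrow> 'b::euclidean_space set \<Rightarrow> ('b \<Rightarrow> 'c::real_normed_vector) \<Rightarrow> bool" where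
  "Ck_on 0 S h \<longleftrightarrow> continuous_on S h"
| "Ck_on (Suc k) S h \<longleftrightarrow> (\<forall>x\<in>S. h differentiable (at x)) \<and>
     (\<forall>v. Ck_on k S (\<lambda>x. frechet_derivative h (at x) v))"

definition smooth_on :: "'b::euclidean_space set \<Rightarrow> ('b \<Rightarrow> 'c::real_normed_vector) \<Rightarrow> bool" where
  "smooth_on S h \<longleftrightarrow> (\<forall>k. Ck_on k S h)"

definition compatible ::
    "('a::topological_space, 'b::euclidean_space) chart \<Rightarrow> ('a, 'b) chart \<Rightarrow> bool" where
  "compatible c d \<longleftrightarrow>
     smooth_on (map_of_chart c ` (dom_of c \<inter> dom_of d)) (map_of_chart d \<circ> inv_chart c) \<and>
     smooth_on (map_of_chart d ` (dom_of c \<inter> dom_of d)) (map_of_chart c \<circ> inv_chart d)"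

definition smooth_atlas :: "('a::topological_space, 'b::euclidean_space) chart set \<Rightarrow> bool" where
  "smooth_atlas A \<longleftrightarrow> (\<forall>c\<in>A. is_chart c) \<and> (\<Union>c\<in>A. dom_of c) = UNIV \<and>
     (\<forall>c\<in>A. \<forall>d\<in>A. compatible c d)"

definition maximal_atlas ::
    "('a::topological_space, 'b::euclidean_space) chart set \<Rightarrow> ('a, 'b) chart set" where
  "maximal_atlas A = {c. is_chart c \<and> (\<forall>d\<in>A. compatible c d)}"

text \<open>
  Embedded submanifolds, described by slice charts. The dimension \<open>k\<close> ranges over
  0, ..., DIM('b).
\<close>

definition submanifold ::
    "('a::topological_space, 'b::euclidean_space) chart set \<Rightarrow> nat \<Rightarrow> 'a set \<Rightarrow> bool" where
  "submanifold A k N \<longleftrightarrow>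
     (\<forall>p\<in>N. \<exists>c\<in>maximal_atlas A. p \<in> dom_of c \<and>
        (\<exists>L. subspace L \<and> dim L = k \<and>
             map_of_chart c ` (N \<inter> dom_of c) = map_of_chart c ` dom_of c \<inter> L))"

text \<open>
  The empty set is vacuously a submanifold of every dimension, hence only nonempty submanifolds
  take part in the determination of the largest dimension.
\<close>

definition max_submanifold_dim ::
    "('a::topological_space, 'b::euclidean_space) chart set \<Rightarrow> 'a set \<Rightarrow> nat \<Rightarrow> bool" where
  "max_submanifold_dim A C k \<longleftrightarrow>
     (\<exists>N. N \<noteq> {} \<and> N \<subseteq> C \<and> submanifold A k N) \<and>
     (\<forall>k' N. N \<noteq> {} \<and> N \<subseteq> C \<and> submanifold A k' N \<longrightarrow> k' \<le> k)"

definition relative_interior ::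
    "('a::topological_space, 'b::euclidean_space) chart set \<Rightarrow> 'a set \<Rightarrow> 'a set" where
  "relative_interior A C =
     \<Union>{N. N \<subseteq> C \<and> (\<exists>k. max_submanifold_dim A C k \<and> submanifold A k N)}"

section \<open>Tangent vectors and Riemannian metrics\<close>

text \<open>
  For each point \<open>p\<close> a chart of the atlas around \<open>p\<close> is chosen once and for all, and the tangent
  space at \<open>p\<close> is identified with 'b by means of this chart: an element of 'b, regarded as a
  tangent vector at \<open>p\<close>, is the list of its components in the chart \<open>chart_at A p\<close>.
\<close>

definition chart_at :: "('a, 'b) chart set \<Rightarrow> 'a \<Rightarrow> ('a, 'b) chart" where
  "chart_at A p = (SOME c. c \<in> A \<and> p \<in> dom_of c)"

text \<open>
  A Riemannian metric is a family \<open>G\<close> of inner products, \<open>G p\<close> on the tangent space at \<open>p\<close>.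
  \<open>metric_coords A G c x u v\<close> is its expression in an arbitrary chart \<open>c\<close>: the inner product of
  the tangent vectors at \<open>inv_chart c x\<close> whose components in \<open>c\<close> are \<open>u\<close> and \<open>v\<close>. The
  derivative of the transition map turns these components into components in the chosen chart.
\<close>

definition metric_coords ::
    "('a, 'b::euclidean_space) chart set \<Rightarrow> ('a \<Rightarrow> 'b \<Rightarrow> 'b \<Rightarrow> real) \<Rightarrow> ('a, 'b) chart
      \<Rightarrow> 'b \<Rightarrow> 'b \<Rightarrow> 'b \<Rightarrow> real" where
  "metric_coords A G c x u v =
     (let p = inv_chart c x;
          D = frechet_derivative (map_of_chart (chart_at A p) \<circ> inv_chart c) (at x)
      in G p (D u) (D v))"

definition riemannian_metric ::
    "('a::topological_space, 'b::euclidean_space) chart set \<Rightarrow> ('a \<Rightarrow> 'b \<Rightarrow> 'b \<Rightarrow> real)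
      \<Rightarrow> bool" where
  "riemannian_metric A G \<longleftrightarrow>
     (\<forall>p. bilinear (G p) \<and> (\<forall>u v. G p u v = G p v u) \<and> (\<forall>u. u \<noteq> 0 \<longrightarrow> 0 < G p u u)) \<and>
     (\<forall>c\<in>A. \<forall>u v. smooth_on (map_of_chart c ` dom_of c) (\<lambda>x. metric_coords A G c x u v))"

definition riemannian_manifold ::
    "('a::t2_space, 'b::euclidean_space) chart set \<Rightarrow> ('a \<Rightarrow> 'b \<Rightarrow> 'b \<Rightarrow> real) \<Rightarrow> bool" where
  "riemannian_manifold A G \<longleftrightarrow> smooth_atlas A \<and> countable A \<and> riemannian_metric A G"

definition rnorm :: "('a \<Rightarrow> 'b \<Rightarrow> 'b \<Rightarrow> real) \<Rightarrow> 'a \<Rightarrow> 'b \<Rightarrow> real" where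
  "rnorm G p v = sqrt (G p v v)"

definition differentiable_at_point ::
    "('a::topological_space, 'b::euclidean_space) chart set \<Rightarrow> ('a \<Rightarrow> real) \<Rightarrow> 'a \<Rightarrow> bool" where
  "differentiable_at_point A h p \<longleftrightarrow>
     (h \<circ> inv_chart (chart_at A p)) differentiable (at (map_of_chart (chart_at A p) p))"

definition differential ::
    "('a::topological_space, 'b::euclidean_space) chart set \<Rightarrow> ('a \<Rightarrow> real) \<Rightarrow> 'a \<Rightarrow> 'b \<Rightarrow> real" where
  "differential A h p =
     frechet_derivative (h \<circ> inv_chart (chart_at A p)) (at (map_of_chart (chart_at A p) p))"

definition grad ::
    "('a::topological_space, 'b::euclidean_space) chart set \<Rightarrow> ('a \<Rightarrow> 'b \<Rightarrow> 'b \<Rightarrow> real)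
      \<Rightarrow> ('a \<Rightarrow> real) \<Rightarrow> 'a \<Rightarrow> 'b" where
  "grad A G h p = (THE v. \<forall>w. G p v w = differential A h p w)"

section \<open>Curves, distance and geodesics\<close>

text \<open>The velocity at time \<open>t\<close> of a curve on \<open>J\<close>, a tangent vector at \<open>\<gamma> t\<close>.\<close>

definition velocity ::
    "('a, 'b::euclidean_space) chart set \<Rightarrow> (real \<Rightarrow> 'a) \<Rightarrow> real set \<Rightarrow> real \<Rightarrow> 'b" where
  "velocity A \<gamma> J t = vector_derivative (map_of_chart (chart_at A (\<gamma> t)) \<circ> \<gamma>) (at t within J)"

definition C1_curve ::
    "('a::topological_space, 'b::euclidean_space) chart set \<Rightarrow> (real \<Rightarrow> 'a) \<Rightarrow> real set \<Rightarrow> bool" where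
  "C1_curve A \<gamma> J \<longleftrightarrow> continuous_on J \<gamma> \<and>
     (\<forall>c\<in>A. \<exists>\<xi>'. continuous_on (J \<inter> \<gamma> -` dom_of c) \<xi>' \<and>
        (\<forall>t\<in>J \<inter> \<gamma> -` dom_of c.
           ((map_of_chart c \<circ> \<gamma>) has_vector_derivative \<xi>' t) (at t within J)))"

definition piecewise_C1_curve ::
    "('a::topological_space, 'b::euclidean_space) chart set \<Rightarrow> (real \<Rightarrow> 'a) \<Rightarrow> bool" where
  "piecewise_C1_curve A \<gamma> \<longleftrightarrow>
     (\<exists>(s :: nat \<Rightarrow> real) n. s 0 = 0 \<and> s n = 1 \<and>
        (\<forall>i<n. s i < s (Suc i) \<and> C1_curve A \<gamma> {s i..s (Suc i)}))"

definition curve_length ::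
    "('a, 'b::euclidean_space) chart set \<Rightarrow> ('a \<Rightarrow> 'b \<Rightarrow> 'b \<Rightarrow> real) \<Rightarrow> (real \<Rightarrow> 'a) \<Rightarrow> real" where
  "curve_length A G \<gamma> = integral {0..1} (\<lambda>t. rnorm G (\<gamma> t) (velocity A \<gamma> {0..1} t))"

definition rdist ::
    "('a::topological_space, 'b::euclidean_space) chart set \<Rightarrow> ('a \<Rightarrow> 'b \<Rightarrow> 'b \<Rightarrow> real)
      \<Rightarrow> 'a \<Rightarrow> 'a \<Rightarrow> real" where
  "rdist A G x y = Inf {curve_length A G \<gamma> |\<gamma>. piecewise_C1_curve A \<gamma> \<and> \<gamma> 0 = x \<and> \<gamma> 1 = y}"

definition rball ::
    "('a::topological_space, 'b::euclidean_space) chart set \<Rightarrow> ('a \<Rightarrow> 'b \<Rightarrow> 'b \<Rightarrow> real)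
      \<Rightarrow> 'a \<Rightarrow> real \<Rightarrow> 'a set" where
  "rball A G p r = {q. rdist A G p q < r}"

text \<open>
  \<open>christoffel A G c x u v w\<close> is the inner product of the covariant derivative of the constant
  field \<open>v\<close> along \<open>u\<close>, with respect to the Levi-Civita connection in the chart \<open>c\<close>, with \<open>w\<close>
  (Christoffel symbols of the first kind, Koszul formula).
\<close>

definition christoffel ::
    "('a, 'b::euclidean_space) chart set \<Rightarrow> ('a \<Rightarrow> 'b \<Rightarrow> 'b \<Rightarrow> real) \<Rightarrow> ('a, 'b) chart
      \<Rightarrow> 'b \<Rightarrow> 'b \<Rightarrow> 'b \<Rightarrow> 'b \<Rightarrow> real" where
  "christoffel A G c x u v w =
     (frechet_derivative (\<lambda>y. metric_coords A G c y v w) (at x) u +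
      frechet_derivative (\<lambda>y. metric_coords A G c y u w) (at x) v -
      frechet_derivative (\<lambda>y. metric_coords A G c y u v) (at x) w) / 2"

text \<open>
  A geodesic on an interval \<open>J\<close> is a curve whose velocity is parallel along it. In the chart \<open>c\<close>,
  with the first and second derivatives \<open>\<xi>'\<close> and \<open>\<xi>''\<close> of the coordinate expression, this is
  the vanishing of the inner product of the covariant derivative of the velocity with every \<open>w\<close>.
  Constant curves are geodesics.
\<close>

definition geodesic ::
    "('a::topological_space, 'b::euclidean_space) chart set \<Rightarrow> ('a \<Rightarrow> 'b \<Rightarrow> 'b \<Rightarrow> real)
      \<Rightarrow> (real \<Rightarrow> 'a) \<Rightarrow> real set \<Rightarrow> bool" where
  "geodesic A G \<gamma> J \<longleftrightarrow> is_interval J \<and> continuous_on J \<gamma> \<and>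
     (\<forall>c\<in>A. \<exists>\<xi>' \<xi>''. \<forall>t\<in>J \<inter> \<gamma> -` dom_of c.
        ((map_of_chart c \<circ> \<gamma>) has_vector_derivative \<xi>' t) (at t within J) \<and>
        (\<xi>' has_vector_derivative \<xi>'' t) (at t within J) \<and>
        (\<forall>w. metric_coords A G c (map_of_chart c (\<gamma> t)) (\<xi>'' t) w +
             christoffel A G c (map_of_chart c (\<gamma> t)) (\<xi>' t) (\<xi>' t) w = 0))"

text \<open>
  The manifold is not assumed complete: \<open>exp_map A G p v\<close> is meaningful only for \<open>v\<close> in
  \<open>exp_domain A G p\<close>, where it is the value at time 1 of the geodesic starting at \<open>p\<close> with
  velocity \<open>v\<close>, which is unique on [0,1].
\<close>

definition initial_geodesic ::
    "('a::topological_space, 'b::euclidean_space) chart set \<Rightarrow> ('a \<Rightarrow> 'b \<Rightarrow> 'b \<Rightarrow> real)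
      \<Rightarrow> 'a \<Rightarrow> 'b \<Rightarrow> (real \<Rightarrow> 'a) \<Rightarrow> bool" where
  "initial_geodesic A G p v \<gamma> \<longleftrightarrow>
     geodesic A G \<gamma> {0..1} \<and> \<gamma> 0 = p \<and> velocity A \<gamma> {0..1} 0 = v"

definition exp_domain ::
    "('a::topological_space, 'b::euclidean_space) chart set \<Rightarrow> ('a \<Rightarrow> 'b \<Rightarrow> 'b \<Rightarrow> real)
      \<Rightarrow> 'a \<Rightarrow> 'b set" where
  "exp_domain A G p = {v. \<exists>\<gamma>. initial_geodesic A G p v \<gamma>}"

definition exp_map ::
    "('a::topological_space, 'b::euclidean_space) chart set \<Rightarrow> ('a \<Rightarrow> 'b \<Rightarrow> 'b \<Rightarrow> real)
      \<Rightarrow> 'a \<Rightarrow> 'b \<Rightarrow> 'a" where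
  "exp_map A G p v = (SOME \<gamma>. initial_geodesic A G p v \<gamma>) 1"

section \<open>Geodesic convexity\<close>

definition geodesic_convex_fun ::
    "('a::topological_space, 'b::euclidean_space) chart set \<Rightarrow> ('a \<Rightarrow> 'b \<Rightarrow> 'b \<Rightarrow> real)
      \<Rightarrow> ('a \<Rightarrow> real) \<Rightarrow> bool" where
  "geodesic_convex_fun A G h \<longleftrightarrow> (\<forall>\<gamma> J. geodesic A G \<gamma> J \<longrightarrow> convex_on J (h \<circ> \<gamma>))"

text \<open>
  Geodesic segments are parametrized on [0,1], proportionally to arc length; uniqueness of a
  segment is equality of the parametrizations on [0,1].
\<close>

definition minimal_geodesic ::
    "('a::topological_space, 'b::euclidean_space) chart set \<Rightarrow> ('a \<Rightarrow> 'b \<Rightarrow> 'b \<Rightarrow> real)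
      \<Rightarrow> 'a \<Rightarrow> 'a \<Rightarrow> (real \<Rightarrow> 'a) \<Rightarrow> bool" where
  "minimal_geodesic A G x y \<gamma> \<longleftrightarrow>
     geodesic A G \<gamma> {0..1} \<and> \<gamma> 0 = x \<and> \<gamma> 1 = y \<and> curve_length A G \<gamma> = rdist A G x y"

definition strongly_geodesic_convex ::
    "('a::topological_space, 'b::euclidean_space) chart set \<Rightarrow> ('a \<Rightarrow> 'b \<Rightarrow> 'b \<Rightarrow> real)
      \<Rightarrow> 'a set \<Rightarrow> bool" where
  "strongly_geodesic_convex A G K \<longleftrightarrow>
     (\<forall>x\<in>K. \<forall>y\<in>K. \<exists>\<gamma>. minimal_geodesic A G x y \<gamma> \<and> \<gamma> ` {0..1} \<subseteq> K \<and>
        (\<forall>\<gamma>'. minimal_geodesic A G x y \<gamma>' \<longrightarrow> (\<forall>t\<in>{0..1}. \<gamma>' t = \<gamma> t)))"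

text \<open>
  The radius is infinite when all balls around \<open>p\<close> qualify, as in a Euclidean space, and the
  supremum is attained when it is finite.
\<close>

definition geodesic_convex_radius ::
    "('a::topological_space, 'b::euclidean_space) chart set \<Rightarrow> ('a \<Rightarrow> 'b \<Rightarrow> 'b \<Rightarrow> real)
      \<Rightarrow> 'a \<Rightarrow> ereal" where
  "geodesic_convex_radius A G p =
     Sup {ereal \<rho> |\<rho>. 0 < \<rho> \<and>
       (\<forall>r. 0 < r \<and> r \<le> \<rho> \<longrightarrow> strongly_geodesic_convex A G (rball A G p r) \<and>
          (\<forall>\<gamma>. geodesic A G \<gamma> {0..1} \<and> \<gamma> ` {0..1} \<subseteq> rball A G p r \<longrightarrow>
               minimal_geodesic A G (\<gamma> 0) (\<gamma> 1) \<gamma>))}"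

text \<open>
  A set \<open>C\<close> is locally geodesic convex iff at every point of its closure there is a radius
  \<open>\<epsilon>\<close> with the following property.
\<close>

definition local_convexity_radius ::
    "('a::topological_space, 'b::euclidean_space) chart set \<Rightarrow> ('a \<Rightarrow> 'b \<Rightarrow> 'b \<Rightarrow> real)
      \<Rightarrow> 'a set \<Rightarrow> 'a \<Rightarrow> real \<Rightarrow> bool" where
  "local_convexity_radius A G C p \<epsilon> \<longleftrightarrow>
     0 < \<epsilon> \<and> ereal \<epsilon> < geodesic_convex_radius A G p \<and>
     strongly_geodesic_convex A G (C \<inter> rball A G p \<epsilon>)"

definition locally_geodesic_convex ::
    "('a::topological_space, 'b::euclidean_space) chart set \<Rightarrow> ('a \<Rightarrow> 'b \<Rightarrow> 'b \<Rightarrow> real)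
      \<Rightarrow> 'a set \<Rightarrow> bool" where
  "locally_geodesic_convex A G C \<longleftrightarrow> (\<forall>p\<in>closure C. \<exists>\<epsilon>. local_convexity_radius A G C p \<epsilon>)"

section \<open>Cones\<close>

text \<open>
  The tangent cone of a locally geodesic convex set \<open>C\<close> at \<open>p \<in> C\<close> does not depend on the choice
  of the radius \<open>\<epsilon>\<close> provided by local geodesic convexity; any such radius is admitted.
\<close>

definition tangent_cone ::
    "('a::topological_space, 'b::euclidean_space) chart set \<Rightarrow> ('a \<Rightarrow> 'b \<Rightarrow> 'b \<Rightarrow> real)
      \<Rightarrow> 'a set \<Rightarrow> 'a \<Rightarrow> 'b set" where
  "tangent_cone A G C p =
     {v. v \<noteq> 0 \<and> (\<exists>\<epsilon> t. local_convexity_radius A G C p \<epsilon> \<and> 0 < t \<and> t < \<epsilon> \<and>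
            (t / rnorm G p v) *\<^sub>R v \<in> exp_domain A G p \<and>
            exp_map A G p ((t / rnorm G p v) *\<^sub>R v) \<in> relative_interior A C)} \<union> {0}"

definition feasible_set :: "nat \<Rightarrow> (nat \<Rightarrow> 'a \<Rightarrow> real) \<Rightarrow> 'a set" where
  "feasible_set l g = {x. \<forall>i\<in>{1..l}. g i x \<le> 0}"

definition active_indices :: "nat \<Rightarrow> (nat \<Rightarrow> 'a \<Rightarrow> real) \<Rightarrow> 'a \<Rightarrow> nat set" where
  "active_indices l g x = {i\<in>{1..l}. g i x = 0}"

definition linearization_cone ::
    "('a::topological_space, 'b::euclidean_space) chart set \<Rightarrow> ('a \<Rightarrow> 'b \<Rightarrow> 'b \<Rightarrow> real)
      \<Rightarrow> nat \<Rightarrow> (nat \<Rightarrow> 'a \<Rightarrow> real) \<Rightarrow> 'a \<Rightarrow> 'b set" where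
  "linearization_cone A G l g x =
     {y. \<forall>i\<in>active_indices l g x. G x (grad A G (g i) x) y \<le> 0}"

definition local_optimal ::
    "('a::topological_space \<Rightarrow> real) \<Rightarrow> 'a set \<Rightarrow> 'a \<Rightarrow> bool" where
  "local_optimal f S xb \<longleftrightarrow>
     xb \<in> S \<and> (\<exists>U. open U \<and> xb \<in> U \<and> (\<forall>x\<in>S \<inter> U. f x \<ge> f xb))"

end

theory Submission
  imports Defs
begin

text \<open>
  The proof is the classical one of the Karush-Kuhn-Tucker theorem under Guignard's
  constraint qualification; geometry enters only through one geodesic at a time.

  A nonzero tangent vector \<open>v\<close> of the tangent cone at \<open>xb\<close> comes with a geodesic \<open>\<gamma>\<close> that starts
  at \<open>xb\<close> in the direction of \<open>v\<close> and ends in the feasible set. Each constraint is convex along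
  \<open>\<gamma>\<close> and nonpositive at both ends, so the whole of \<open>\<gamma>\<close> is feasible. Hence \<open>f \<circ> \<gamma>\<close> has a local
  minimum at its left end and its one-sided derivative there, which is a positive multiple of the
  differential of \<open>f\<close> at \<open>v\<close>, is nonnegative
  (\<open>differential_nonneg_on_tangent_cone\<close>). This inequality is linear in \<open>v\<close>, so it passes to the
  convex hull of the tangent cone and, by the constraint qualification, to the linearization cone.
  In terms of gradients: whenever \<open>y\<close> has nonpositive inner product with all active constraint
  gradients, it has nonnegative inner product with the gradient of \<open>f\<close>. Farkas' lemma, transported
  from the Euclidean inner product to the Riemannian one
  (\<open>farkas_positive_definite\<close>), yields the multipliers of the active constraints; those of the
  inactive constraints are zero.
\<close>

section \<open>Farkas' lemma\<close>

text \<open>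
  If \<open>- b\<close> were outside the cone generated by the \<open>a i\<close>, which is closed because it is finitely
  generated, a hyperplane would separate it from the cone, and the normal of the hyperplane would
  violate the hypothesis.
\<close>

lemma farkas_inner:
  fixes a :: "'i \<Rightarrow> 'b::euclidean_space"
  assumes "finite I"
    and imp: "\<And>y. (\<And>i. i \<in> I \<Longrightarrow> a i \<bullet> y \<le> 0) \<Longrightarrow> 0 \<le> b \<bullet> y"
  obtains lam where "\<And>i. i \<in> I \<Longrightarrow> 0 \<le> lam i" "b + (\<Sum>i\<in>I. lam i *\<^sub>R a i) = 0"
proof -
  let ?C = "convex_cone hull (a ` I)"
  let ?K = "{\<Sum>i\<in>I. lam i *\<^sub>R a i | lam. \<forall>i\<in>I. 0 \<le> lam i}"
  have "- b \<in> ?C"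
  proof (rule ccontr)
    assume "- b \<notin> ?C"
    then obtain n \<beta> where n: "n \<bullet> (- b) < \<beta>" "\<And>x. x \<in> ?C \<Longrightarrow> \<beta> < n \<bullet> x"
      using separating_hyperplane_closed_point[of ?C "- b"] \<open>finite I\<close>
      by (auto simp: convex_convex_cone_hull closed_convex_cone_hull)
    have "\<beta> < 0"
      using n(2)[OF convex_cone_hull_contains_0] by simp
    have "a i \<bullet> (- n) \<le> 0" if "i \<in> I" for i
    proof (rule ccontr)
      assume "\<not> a i \<bullet> (- n) \<le> 0"
      then have neg: "n \<bullet> a i < 0"
        by (simp add: inner_commute)
      \<comment> \<open>On the ray through \<open>a i\<close> the functional \<open>n\<close> would reach the value \<open>\<beta>\<close>.\<close>
      have "(\<beta> / (n \<bullet> a i)) *\<^sub>R a i \<in> ?C"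
        using neg \<open>\<beta> < 0\<close> that
        by (intro convex_cone_hull_mul hull_inc) (auto simp: divide_nonpos_nonpos)
      from n(2)[OF this] neg show False
        by simp
    qed
    then have "0 \<le> b \<bullet> (- n)"
      by (rule imp)
    then show False
      using n(1) \<open>\<beta> < 0\<close> by (simp add: inner_commute)
  qed
  also have "?C \<subseteq> ?K"
  proof (rule hull_minimal)
    show "a ` I \<subseteq> ?K"
    proof
      fix x assume "x \<in> a ` I"
      then obtain j where j: "j \<in> I" "x = a j"
        by auto
      have "x = (\<Sum>i\<in>I. (if i = j then 1 else 0) *\<^sub>R a i)"
        using j \<open>finite I\<close> by (simp add: if_distrib[of "\<lambda>c. c *\<^sub>R _"] cong: if_cong)
      then show "x \<in> ?K"
        by (intro CollectI exI[of _ "\<lambda>i. if i = j then 1 else 0"]) simp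
    qed
    have "0 \<in> ?K"
      by (intro CollectI exI[of _ "\<lambda>_. 0"]) simp
    moreover have "x + y \<in> ?K" if "x \<in> ?K" "y \<in> ?K" for x y
    proof -
      obtain c d where "\<forall>i\<in>I. 0 \<le> c i" "x = (\<Sum>i\<in>I. c i *\<^sub>R a i)"
        "\<forall>i\<in>I. 0 \<le> d i" "y = (\<Sum>i\<in>I. d i *\<^sub>R a i)"
        using \<open>x \<in> ?K\<close> \<open>y \<in> ?K\<close> by auto
      then show ?thesis
        by (intro CollectI exI[of _ "\<lambda>i. c i + d i"])
          (simp add: scaleR_add_left sum.distrib)
    qed
    moreover have "r *\<^sub>R x \<in> ?K" if "x \<in> ?K" "0 \<le> r" for x r
    proof -
      obtain c where "\<forall>i\<in>I. 0 \<le> c i" "x = (\<Sum>i\<in>I. c i *\<^sub>R a i)"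
        using \<open>x \<in> ?K\<close> by auto
      then show ?thesis
        using \<open>0 \<le> r\<close> by (intro CollectI exI[of _ "\<lambda>i. r * c i"]) (simp add: scaleR_sum_right)
    qed
    ultimately show "convex_cone ?K"
      unfolding convex_cone_iff by blast
  qed
  finally obtain lam where "\<forall>i\<in>I. 0 \<le> lam i" "- b = (\<Sum>i\<in>I. lam i *\<^sub>R a i)"
    by blast
  then show ?thesis
    by (intro that[of lam]) (auto simp flip: \<open>- b = _\<close>)
qed

text \<open>
  The vectors \<open>T u\<close> are those that represent the functionals \<open>B u\<close> in the Euclidean inner
  product. Through \<open>T\<close>, Farkas' lemma and the representation of functionals, which are known for
  \<open>\<bullet>\<close>, carry over to a Riemannian inner product \<open>B\<close>.
\<close>

lemma bilinear_eq_inner_linear: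
  fixes B :: "'b::euclidean_space \<Rightarrow> 'b \<Rightarrow> real"
  assumes "bilinear B"
  obtains T where "linear T" "\<And>u w. B u w = T u \<bullet> w"
proof
  let ?T = "\<lambda>u. adjoint (B u) 1"
  have lin: "linear (B u)" for u
    using assms by (simp add: bilinear_def)
  show eq: "B u w = ?T u \<bullet> w" for u w
    using adjoint_works[OF lin, of w u 1] by (simp add: inner_commute)
  show "linear ?T"
  proof (rule linearI)
    show "?T (u + v) = ?T u + ?T v" for u v
      by (rule vector_eq_rdot[THEN iffD1])
        (simp add: inner_add_left bilinear_ladd[OF assms] flip: eq)
    show "?T (c *\<^sub>R u) = c *\<^sub>R ?T u" for c u
      by (rule vector_eq_rdot[THEN iffD1])
        (simp add: bilinear_lmul[OF assms] flip: eq)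
  qed
qed

text \<open>
  The Euclidean version provides multipliers with which the image under \<open>T\<close> of the combination
  vanishes; positive definiteness makes \<open>T\<close> injective.
\<close>

lemma farkas_positive_definite:
  fixes B :: "'b::euclidean_space \<Rightarrow> 'b \<Rightarrow> real" and a :: "'i \<Rightarrow> 'b"
  assumes "bilinear B" and pos: "\<And>u. u \<noteq> 0 \<Longrightarrow> 0 < B u u"
    and "finite I"
    and imp: "\<And>y. (\<And>i. i \<in> I \<Longrightarrow> B (a i) y \<le> 0) \<Longrightarrow> 0 \<le> B b y"
  obtains lam where "\<And>i. i \<in> I \<Longrightarrow> 0 \<le> lam i" "b + (\<Sum>i\<in>I. lam i *\<^sub>R a i) = 0"
proof -
  obtain T where T: "linear T" "\<And>u w. B u w = T u \<bullet> w"
    using bilinear_eq_inner_linear[OF \<open>bilinear B\<close>] by blast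
  obtain lam where lam: "\<And>i. i \<in> I \<Longrightarrow> 0 \<le> lam i" "T b + (\<Sum>i\<in>I. lam i *\<^sub>R T (a i)) = 0"
    using farkas_inner[of I "\<lambda>i. T (a i)" "T b"] \<open>finite I\<close> imp unfolding T(2) by blast
  have "T (b + (\<Sum>i\<in>I. lam i *\<^sub>R a i)) = 0"
    using lam(2) by (simp add: linear_add[OF T(1)] linear_sum[OF T(1)] linear_scale[OF T(1)])
  then have "b + (\<Sum>i\<in>I. lam i *\<^sub>R a i) = 0"
    using pos[of "b + (\<Sum>i\<in>I. lam i *\<^sub>R a i)"] T(2) by fastforce
  with lam(1) show ?thesis
    using that by blast
qed

section \<open>The gradient\<close>

text \<open>
  The gradient is defined by a definite description, which says something about it only once
  the vector described exists and is unique.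
\<close>

lemma representing_vector_exists_unique:
  fixes B :: "'b::euclidean_space \<Rightarrow> 'b \<Rightarrow> real"
  assumes "bilinear B" and pos: "\<And>u. u \<noteq> 0 \<Longrightarrow> 0 < B u u" and "linear \<phi>"
  shows "\<exists>!v. \<forall>w. B v w = \<phi> w"
proof -
  obtain T where T: "linear T" "\<And>u w. B u w = T u \<bullet> w"
    using bilinear_eq_inner_linear[OF \<open>bilinear B\<close>] by blast
  have "u = 0" if "T u = 0" for u
    using pos[of u] T(2)[of u u] that by fastforce
  then have "inj T"
    by (simp add: linear_injective_0[OF T(1)])
  then have "surj T"
    using linear_injective_imp_surjective[OF T(1)] by simp
  then obtain v where v: "T v = adjoint \<phi> 1"
    by (metis surjD)
  have \<phi>: "\<phi> w = T v \<bullet> w" for w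
    using adjoint_works[OF \<open>linear \<phi>\<close>, of w 1] v by (simp add: inner_commute)
  show ?thesis
  proof (rule ex1I[of _ v])
    show "\<forall>w. B v w = \<phi> w"
      by (simp add: T(2) \<phi>)
    show "u = v" if "\<forall>w. B u w = \<phi> w" for u
      using that \<open>inj T\<close> by (metis T(2) \<phi> injD vector_eq_rdot)
  qed
qed

lemma linear_differential:
  "differentiable_at_point A h p \<Longrightarrow> linear (differential A h p)"
  unfolding differentiable_at_point_def differential_def
  by (rule linear_frechet_derivative)

lemma riemannian_metric_grad:
  assumes "riemannian_metric A G" "differentiable_at_point A h p"
  shows "G p (grad A G h p) w = differential A h p w"
proof -
  have "\<exists>!v. \<forall>w. G p v w = differential A h p w"
    using assms(1) by (intro representing_vector_exists_unique linear_differential[OF assms(2)])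
      (auto simp: riemannian_metric_def)
  from theI'[OF this] show ?thesis
    unfolding grad_def by blast
qed

section \<open>Differentiation along geodesics\<close>

text \<open>
  By continuity \<open>\<gamma>\<close> stays in the domain of the chart chosen at \<open>p\<close> for a short time, so that
  \<open>h \<circ> \<gamma>\<close> factors near 0 through the coordinate expressions of \<open>h\<close> and \<open>\<gamma>\<close> there.
\<close>

lemma geodesic_chain_rule_at_start:
  assumes "smooth_atlas A" "initial_geodesic A G p v \<gamma>" "differentiable_at_point A h p"
  shows "((h \<circ> \<gamma>) has_real_derivative differential A h p v) (at 0 within {0..1})"
proof -
  define c where "c = chart_at A p"
  have geo: "geodesic A G \<gamma> {0..1}" and [simp]: "\<gamma> 0 = p" and vel: "velocity A \<gamma> {0..1} 0 = v"
    using assms(2) by (auto simp: initial_geodesic_def)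
  have "\<exists>c. c \<in> A \<and> p \<in> dom_of c"
    using assms(1) unfolding smooth_atlas_def by blast
  from someI_ex[OF this] have c: "c \<in> A" "p \<in> dom_of c"
    by (auto simp: c_def chart_at_def)
  have chart: "is_chart c"
    using assms(1) c(1) by (auto simp: smooth_atlas_def)
  have inv: "inv_chart c (map_of_chart c q) = q" if "q \<in> dom_of c" for q
    using chart that unfolding is_chart_def homeomorphism_def by blast

  obtain \<xi>' where "((map_of_chart c \<circ> \<gamma>) has_vector_derivative \<xi>') (at 0 within {0..1})"
    using geo c unfolding geodesic_def by fastforce
  moreover from this have "\<xi>' = v"
    using vel vector_derivative_within_closed_interval[of 0 1 0 "map_of_chart c \<circ> \<gamma>" \<xi>']
    by (simp add: velocity_def c_def)
  ultimately have curve: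
    "((map_of_chart c \<circ> \<gamma>) has_derivative (\<lambda>s. s *\<^sub>R v)) (at 0 within {0..1})"
    by (simp add: has_vector_derivative_def)
  have "((h \<circ> inv_chart c) has_derivative differential A h p) (at (map_of_chart c p))"
    using assms(3) unfolding differentiable_at_point_def differential_def c_def
    by (rule frechet_derivative_works[THEN iffD1])
  then have "((h \<circ> inv_chart c) has_derivative differential A h p)
      (at ((map_of_chart c \<circ> \<gamma>) 0) within (map_of_chart c \<circ> \<gamma>) ` {0..1})"
    by (auto intro: has_derivative_at_withinI)
  from diff_chain_within[OF curve this]
  have chain: "((h \<circ> inv_chart c \<circ> (map_of_chart c \<circ> \<gamma>)) has_derivative
      (differential A h p \<circ> (\<lambda>s. s *\<^sub>R v))) (at 0 within {0..1})" .

  have "continuous_on {0..1} \<gamma>"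
    using geo unfolding geodesic_def by blast
  then have "(\<gamma> \<longlongrightarrow> \<gamma> 0) (at 0 within {0..1})"
    unfolding continuous_on_def by (rule bspec) simp
  then have "\<forall>\<^sub>F s in at 0 within {0..1}. \<gamma> s \<in> dom_of c"
    by (rule topological_tendstoD) (use chart c(2) in \<open>simp_all add: is_chart_def\<close>)
  then have "\<forall>\<^sub>F s in at 0 within {0..1}.
      (h \<circ> inv_chart c \<circ> (map_of_chart c \<circ> \<gamma>)) s = (h \<circ> \<gamma>) s"
    by eventually_elim (simp add: inv)
  from has_derivative_transform_eventually[OF chain this]
  have "((h \<circ> \<gamma>) has_derivative (differential A h p \<circ> (\<lambda>s. s *\<^sub>R v))) (at 0 within {0..1})"
    by (simp add: o_def inv c(2))
  then show ?thesis
    by (rule has_derivative_imp_has_field_derivative)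
      (simp add: linear_scale[OF linear_differential[OF assms(3)]])
qed

lemma geodesic_with_feasible_ends_feasible:
  assumes "geodesic A G \<gamma> {0..1}" "\<forall>i\<in>{1..l}. geodesic_convex_fun A G (g i)"
    and ends: "\<gamma> 0 \<in> feasible_set l g" "\<gamma> 1 \<in> feasible_set l g" and s: "s \<in> {0..1}"
  shows "\<gamma> s \<in> feasible_set l g"
  unfolding feasible_set_def
proof (intro CollectI ballI)
  fix i assume i: "i \<in> {1..l}"
  have "convex_on {0..1} (g i \<circ> \<gamma>)"
    using assms i by (auto simp: geodesic_convex_fun_def)
  from convex_onD[OF this, of s 0 1] s
  have "g i (\<gamma> s) \<le> (1 - s) * g i (\<gamma> 0) + s * g i (\<gamma> 1)"
    by simp
  also have "\<dots> \<le> 0"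
    using ends i s by (intro add_nonpos_nonpos mult_nonneg_nonpos) (auto simp: feasible_set_def)
  finally show "g i (\<gamma> s) \<le> 0" .
qed

section \<open>First-order optimality\<close>

text \<open>
  Were the derivative of \<open>h\<close> along \<open>\<gamma>\<close> negative at the start, \<open>h\<close> would be smaller than \<open>h p\<close> at
  points of \<open>\<gamma>\<close> arbitrarily close to \<open>p\<close>.
\<close>

lemma differential_nonneg_along_feasible_geodesic:
  assumes "smooth_atlas A" "initial_geodesic A G p v \<gamma>" "differentiable_at_point A h p"
    and "local_optimal h S p" and feas: "\<And>s. s \<in> {0..1} \<Longrightarrow> \<gamma> s \<in> S"
  shows "0 \<le> differential A h p v"
proof (rule ccontr)
  assume "\<not> 0 \<le> differential A h p v"
  then obtain d where d: "0 < d" "\<And>s. 0 < s \<Longrightarrow> s \<le> 1 \<Longrightarrow> s < d \<Longrightarrow> h (\<gamma> s) < h (\<gamma> 0)"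
    using has_real_derivative_neg_dec_right[OF geodesic_chain_rule_at_start[OF assms(1-3)]]
    by auto
  obtain U where U: "open U" "p \<in> U" "\<And>x. x \<in> S \<Longrightarrow> x \<in> U \<Longrightarrow> h p \<le> h x"
    using assms(4) by (auto simp: local_optimal_def)
  have start: "\<gamma> 0 = p" and "continuous_on {0..1} \<gamma>"
    using assms(2) by (auto simp: initial_geodesic_def geodesic_def)
  then have "(\<gamma> \<longlongrightarrow> \<gamma> 0) (at 0 within {0..1})"
    unfolding continuous_on_def by (meson atLeastAtMost_iff order_refl zero_le_one)
  then have "(\<gamma> \<longlongrightarrow> p) (at_right 0)"
    by (simp add: start at_within_Icc_at_right)
  then have "\<forall>\<^sub>F s in at_right 0. \<gamma> s \<in> U"
    by (rule topological_tendstoD) (fact U)+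
  moreover have "\<forall>\<^sub>F s in at_right 0. s < min d 1"
    using d(1) by (intro order_tendstoD(2)[of _ 0]) auto
  moreover have "\<forall>\<^sub>F s in at_right (0::real). 0 < s"
    by (simp add: eventually_at_right_less)
  ultimately have "\<forall>\<^sub>F s in at_right (0::real). False"
  proof eventually_elim
    case (elim s)
    then show ?case
      using d(2)[of s] U(3)[OF feas[of s]] start by auto
  qed
  then show False
    by simp
qed

lemma relative_interior_subset: "relative_interior A C \<subseteq> C"
  by (auto simp: relative_interior_def)

lemma differential_nonneg_on_tangent_cone:
  assumes "smooth_atlas A" "riemannian_metric A G" "differentiable_at_point A f xb"
    and conv: "\<forall>i\<in>{1..l}. geodesic_convex_fun A G (g i)"
    and opt: "local_optimal f (feasible_set l g) xb"
    and v: "v \<in> tangent_cone A G (feasible_set l g) xb"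
  shows "0 \<le> differential A f xb v"
proof (cases "v = 0")
  case True
  then show ?thesis
    by (simp add: linear_0[OF linear_differential[OF assms(3)]])
next
  case False
  let ?S = "feasible_set l g"
  obtain t where t: "0 < t"
    and dom: "(t / rnorm G xb v) *\<^sub>R v \<in> exp_domain A G xb"
    and ri: "exp_map A G xb ((t / rnorm G xb v) *\<^sub>R v) \<in> relative_interior A ?S"
    using v False by (auto simp: tangent_cone_def)
  define r where "r = t / rnorm G xb v"
  have "0 < r"
    using assms(2) t False by (auto simp: r_def rnorm_def riemannian_metric_def)
  \<comment> \<open>The very geodesic whose endpoint is the value of the exponential map.\<close>
  define \<gamma> where "\<gamma> = (SOME \<gamma>. initial_geodesic A G xb (r *\<^sub>R v) \<gamma>)"
  have init: "initial_geodesic A G xb (r *\<^sub>R v) \<gamma>"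
    using dom unfolding \<gamma>_def r_def exp_domain_def mem_Collect_eq by (rule someI_ex)
  have "\<gamma> 1 \<in> ?S"
    using ri relative_interior_subset[of A ?S] by (auto simp: exp_map_def \<gamma>_def r_def)
  moreover have "\<gamma> 0 \<in> ?S"
    using init opt by (auto simp: initial_geodesic_def local_optimal_def)
  ultimately have "\<gamma> s \<in> ?S" if "s \<in> {0..1}" for s
    using geodesic_with_feasible_ends_feasible[OF _ conv] init that
    by (auto simp: initial_geodesic_def)
  from differential_nonneg_along_feasible_geodesic[OF assms(1) init assms(3) opt this]
  have "0 \<le> r * differential A f xb v"
    by (simp add: linear_scale[OF linear_differential[OF assms(3)]])
  with \<open>0 < r\<close> show ?thesis
    by (simp add: zero_le_mult_iff)
qed

lemma nonneg_on_convex_hull: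
  fixes \<phi> :: "'b::real_vector \<Rightarrow> real"
  assumes "linear \<phi>" "\<And>v. v \<in> K \<Longrightarrow> 0 \<le> \<phi> v" "y \<in> convex hull K"
  shows "0 \<le> \<phi> y"
proof -
  have "convex (\<phi> -` {0..})"
    by (intro convex_linear_vimage assms(1)) simp
  then have "convex hull K \<subseteq> \<phi> -` {0..}"
    using assms(2) by (intro hull_minimal) auto
  then show ?thesis
    using assms(3) by auto
qed

section \<open>The Karush-Kuhn-Tucker conditions\<close>

theorem theorem4p4:
  fixes A :: "('a::t2_space, 'b::euclidean_space) chart set"
    and G :: "'a \<Rightarrow> 'b \<Rightarrow> 'b \<Rightarrow> real"
    and f :: "'a \<Rightarrow> real" and g :: "nat \<Rightarrow> 'a \<Rightarrow> real" and l :: nat and xb :: 'a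
  assumes "riemannian_manifold A G"
    and "simply_connected (UNIV :: 'a set)"
    and "\<forall>x. differentiable_at_point A f x"
    and "\<forall>i\<in>{1..l}. geodesic_convex_fun A G (g i)"
    and "local_optimal f (feasible_set l g) xb"
    and "\<forall>i\<in>{1..l}. differentiable_at_point A (g i) xb"
    and "linearization_cone A G l g xb \<subseteq> convex hull (tangent_cone A G (feasible_set l g) xb)"
  shows "\<exists>lam :: nat \<Rightarrow> real.
     grad A G f xb + (\<Sum>i=1..l. lam i *\<^sub>R grad A G (g i) xb) = 0 \<and>
     (\<forall>i\<in>{1..l}. lam i \<ge> 0 \<and> g i xb \<le> 0 \<and> lam i * g i xb = 0)"
proof -
  let ?I = "active_indices l g xb"
  have atlas: "smooth_atlas A" and metric: "riemannian_metric A G"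
    using assms(1) by (auto simp: riemannian_manifold_def)
  have f: "differentiable_at_point A f xb"
    using assms(3) by blast
  have I: "?I \<subseteq> {1..l}"
    by (auto simp: active_indices_def)
  have "0 \<le> G xb (grad A G f xb) y" if "\<And>i. i \<in> ?I \<Longrightarrow> G xb (grad A G (g i) xb) y \<le> 0" for y
  proof -
    have "y \<in> convex hull (tangent_cone A G (feasible_set l g) xb)"
      using that assms(7) by (auto simp: linearization_cone_def)
    from nonneg_on_convex_hull[OF linear_differential[OF f] _ this]
    have "0 \<le> differential A f xb y"
      using differential_nonneg_on_tangent_cone[OF atlas metric f assms(4,5)] .
    then show ?thesis
      by (simp add: riemannian_metric_grad[OF metric f])
  qed
  moreover have "bilinear (G xb)" "\<And>u. u \<noteq> 0 \<Longrightarrow> 0 < G xb u u" "finite ?I"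
    using metric finite_subset[OF I] by (auto simp: riemannian_metric_def)
  ultimately obtain mu where mu: "\<And>i. i \<in> ?I \<Longrightarrow> 0 \<le> mu i"
    "grad A G f xb + (\<Sum>i\<in>?I. mu i *\<^sub>R grad A G (g i) xb) = 0"
    using farkas_positive_definite[of "G xb" ?I "\<lambda>i. grad A G (g i) xb" "grad A G f xb"] by blast
  define lam where "lam i = (if i \<in> ?I then mu i else 0)" for i
  have "(\<Sum>i=1..l. lam i *\<^sub>R grad A G (g i) xb) = (\<Sum>i\<in>?I. mu i *\<^sub>R grad A G (g i) xb)"
    using I by (intro sum.mono_neutral_cong_right) (auto simp: lam_def)
  moreover have "lam i \<ge> 0 \<and> g i xb \<le> 0 \<and> lam i * g i xb = 0" if "i \<in> {1..l}" for i
    using mu(1)[of i] that assms(5)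
    by (auto simp: lam_def active_indices_def local_optimal_def feasible_set_def)
  ultimately show ?thesis
    using mu(2) by (intro exI[of _ lam]) simp
qed

end
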